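(* Let $R$ be a 2-torsion free associative semiprime ring, let $U$ be a nonzero left ideal of $R$ such that $r_R(U) = 0$, and let $\alpha : R\to R$ be a ring automorphism. If there exists an $(\alpha,\alpha)$-derivation $D : R\to R$ such that $[[D(x),\alpha(x)],\alpha(x)] = 0$ for all $x\in U$, then $D(R)\subseteq Z(R)$ and the ideal of $R$ generated by $D(R)$ is contained in $Z(R)$.
   Context: Rings are associative and not assumed to be unital or commutative. $[x,y]$ denotes $xy-yx$, and $Z(R)$ is the center of $R$. $R$ is semiprime if $aRa = (0)$ implies $a=0$. $R$ is 2-torsion free if $2x=0$ implies $x=0$. $r_R(U)=\{r\in R : Ur = 0\}$ is the right annihilator of $U$ in $R$. An additive map $D : R\to R$ is an $(\alpha,\alpha)$-derivation if $D(xy) = D(x)\alpha(y)+\alpha(x)D(y)$ for all $x,y\in R$. *)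

theory Defs
  imports Complex_Main
begin

text \<open>
  The type class \<^class>\<open>ring\<close> is the class of associative rings that need be neither
  unital nor commutative; a ring is represented by a type of this class.
\<close>

definition commutator :: "'a::ring \<Rightarrow> 'a \<Rightarrow> 'a"
  where "commutator x y = x * y - y * x"

definition ring_center :: "'a::ring set"
  where "ring_center = {z. \<forall>x. z * x = x * z}"

definition semiprime_ring :: "'a::ring itself \<Rightarrow> bool"
  where "semiprime_ring _ \<longleftrightarrow> (\<forall>a::'a. (\<forall>r. a * r * a = 0) \<longrightarrow> a = 0)"

text \<open>Since the ring may lack a unit, \<open>2x\<close> is written as \<open>x + x\<close>.\<close>

definition two_torsion_free :: "'a::ring itself \<Rightarrow> bool"
  where "two_torsion_free _ \<longleftrightarrow> (\<forall>x::'a. x + x = 0 \<longrightarrow> x = 0)"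

definition additive_subgroup :: "'a::ab_group_add set \<Rightarrow> bool"
  where "additive_subgroup I \<longleftrightarrow>
    0 \<in> I \<and> (\<forall>x\<in>I. \<forall>y\<in>I. x + y \<in> I) \<and> (\<forall>x\<in>I. - x \<in> I)"

definition left_ideal :: "'a::ring set \<Rightarrow> bool"
  where "left_ideal I \<longleftrightarrow> additive_subgroup I \<and> (\<forall>r. \<forall>x\<in>I. r * x \<in> I)"

definition two_sided_ideal :: "'a::ring set \<Rightarrow> bool"
  where "two_sided_ideal I \<longleftrightarrow>
    additive_subgroup I \<and> (\<forall>r. \<forall>x\<in>I. r * x \<in> I \<and> x * r \<in> I)"

text \<open>The intersection of all two-sided ideals containing \<open>S\<close>.\<close>

definition ideal_generated_by :: "'a::ring set \<Rightarrow> 'a set"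
  where "ideal_generated_by S = two_sided_ideal hull S"

definition right_annihilator :: "'a::ring set \<Rightarrow> 'a set"
  where "right_annihilator U = {r. \<forall>u\<in>U. u * r = 0}"

definition ring_automorphism :: "('a::ring \<Rightarrow> 'a) \<Rightarrow> bool"
  where "ring_automorphism \<alpha> \<longleftrightarrow>
    bij \<alpha> \<and> additive \<alpha> \<and> (\<forall>x y. \<alpha> (x * y) = \<alpha> x * \<alpha> y)"

text \<open>The two twisting maps of an \<open>(\<alpha>,\<alpha>)\<close>-derivation coincide, so a single argument is used.\<close>

definition twisted_derivation :: "('a::ring \<Rightarrow> 'a) \<Rightarrow> ('a \<Rightarrow> 'a) \<Rightarrow> bool"
  where "twisted_derivation \<alpha> D \<longleftrightarrow>
    additive D \<and> (\<forall>x y. D (x * y) = D x * \<alpha> y + \<alpha> x * D y)"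

end

theory Submission
  imports Defs
begin

text \<open>
  The map \<open>d = \<alpha>\<^sup>-\<^sup>1 \<circ> D\<close> is an ordinary derivation, so \<open>\<alpha>\<close> may be taken to be the
  identity. Fix \<open>x \<in> U\<close>, put \<open>a = d x\<close> and \<open>f = [a, x]\<close>, and write \<open>y' = [y, x]\<close>. Linearizing
  \<open>[[d x, x], x] = 0\<close> and substituting \<open>y x\<close> and \<open>x y\<close> for \<open>y\<close> gives
  \<open>3 y' f + y'' a = 0\<close> and \<open>3 f y' + a y'' = 0\<close> for \<open>y \<in> U\<close>. The first yields
  \<open>3 f y f + 2 f y' a = 0\<close> (replace \<open>y\<close> by \<open>a y\<close>) and then \<open>f y' f = 0\<close> (replace \<open>y\<close> by \<open>y x\<close>).
  The mirror image \<open>3 f y f + 2 a y' f = 0\<close> cannot be reached by the mirrored substitution, since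
  \<open>y a\<close> need not lie in \<open>U\<close>; instead the second identity leads to \<open>K z' + M z = 0\<close> for all
  \<open>z \<in> U\<close>, where \<open>M = 3 f y f + 2 a y' f\<close>, and this forces \<open>M = 0\<close>. Expanding
  \<open>f (y a z)' f = 0\<close> then gives \<open>4 f y f z f = 0\<close>, whence \<open>f = 0\<close>. So \<open>d\<close> is commuting on \<open>U\<close>,
  and a Posner-type argument gives \<open>[r, q] R d(p) = 0\<close> for all \<open>r, q, p\<close>.
\<close>

section \<open>Annihilators relative to a faithful left ideal\<close>

locale faithful_left_ideal =
  fixes U :: "'a::ring set"
  assumes semiprime: "semiprime_ring TYPE('a)"
    and left_ideal: "left_ideal U"
    and right_annihilator: "right_annihilator U = {0}"
begin

lemma add_mem: "x \<in> U \<Longrightarrow> y \<in> U \<Longrightarrow> x + y \<in> U"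
  and diff_mem: "x \<in> U \<Longrightarrow> y \<in> U \<Longrightarrow> x - y \<in> U"
  and mult_mem: "y \<in> U \<Longrightarrow> r * y \<in> U"
  using left_ideal unfolding left_ideal_def additive_subgroup_def
  by (auto simp: diff_conv_add_uminus simp del: add_uminus_conv_diff)

lemma semiprimeD: "(\<And>r. a * r * a = 0) \<Longrightarrow> a = (0::'a)"
  using semiprime unfolding semiprime_ring_def by blast

lemma right_annihilatorD: "(\<And>u. u \<in> U \<Longrightarrow> u * r = 0) \<Longrightarrow> r = 0"
  using right_annihilator unfolding right_annihilator_def by blast

lemma annihilator_swap:
  assumes "\<And>r. a * r * b = (0::'a)"
  shows "b * r * a = 0"
proof (rule semiprimeD)
  fix s
  have "b * r * a * s * (b * r * a) = b * r * (a * s * b) * r * a" by (simp add: mult.assoc)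
  then show "b * r * a * s * (b * r * a) = 0" by (simp add: assms)
qed

lemma annihilator_mult:
  assumes "\<And>r. a * r * b = (0::'a)"
  shows "a * b = 0"
proof (rule semiprimeD)
  fix s
  have "a * b * s * (a * b) = a * (b * s * a) * b" by (simp add: mult.assoc)
  then show "a * b * s * (a * b) = 0" by (simp add: assms)
qed

text \<open>Between two copies of \<open>u * b * s * a\<close> the product
  \<open>a * (t * u) * b\<close> appears, with \<open>t * u\<close> in \<open>U\<close>. So
  semiprimeness kills \<open>u * b * s * a\<close>, and \<open>u\<close> cancels because the right
  annihilator of \<open>U\<close> is zero.\<close>

lemma annihilator_ideal_to_ring:
  assumes "\<And>y. y \<in> U \<Longrightarrow> a * y * b = 0"
  shows "a * r * b = 0"
proof -
  have "b * s * a = 0" for s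
  proof (rule right_annihilatorD)
    fix u assume u: "u \<in> U"
    show "u * (b * s * a) = 0"
    proof (rule semiprimeD)
      fix t
      have "u * (b * s * a) * t * (u * (b * s * a)) = u * b * s * (a * (t * u) * b) * s * a"
        by (simp add: mult.assoc)
      then show "u * (b * s * a) * t * (u * (b * s * a)) = 0"
        using assms[OF mult_mem[OF u]] by simp
    qed
  qed
  then show ?thesis by (rule annihilator_swap)
qed

lemma left_annihilatorD:
  assumes "\<And>u. u \<in> U \<Longrightarrow> a * u = 0"
  shows "a = 0"
proof (rule semiprimeD)
  fix r show "a * r * a = 0" by (rule annihilator_ideal_to_ring) (simp add: assms)
qed

lemma ideal_semiprimeD:
  assumes "\<And>u. u \<in> U \<Longrightarrow> a * u * a = 0"
  shows "a = 0"
  by (rule semiprimeD, rule annihilator_ideal_to_ring, rule assms)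

text \<open>Putting \<open>w * z\<close> for \<open>z\<close> and subtracting the identity at
  \<open>w\<close> times \<open>z\<close> leaves \<open>k * w * commutator z x = 0\<close>; hence
  the two terms of the identity vanish separately.\<close>

lemma constant_of_commutator_identity:
  assumes eq: "\<And>z. z \<in> U \<Longrightarrow> k * commutator z x + m * z = 0"
  shows "m = 0"
proof (rule left_annihilatorD)
  fix z assume z: "z \<in> U"
  have "k * w * commutator z x = 0" if w: "w \<in> U" for w
  proof -
    have "k * w * commutator z x =
      (k * commutator (w * z) x + m * (w * z)) - (k * commutator w x + m * w) * z"
      unfolding commutator_def by (simp add: algebra_simps)
    then show ?thesis by (simp add: eq mult_mem w z)
  qed
  then have "k * r * commutator z x = 0" for r by (rule annihilator_ideal_to_ring)
  then have "k * commutator z x = 0" by (rule annihilator_mult)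
  then show "m * z = 0" using eq[OF z] by simp
qed

end

section \<open>Derivations and their commutators on the left ideal\<close>

locale faithful_left_ideal_derivation = faithful_left_ideal U for U :: "'a::ring set" +
  fixes d :: "'a \<Rightarrow> 'a"
  assumes two_torsion_free: "two_torsion_free TYPE('a)"
    and d_add: "d (x + y) = d x + d y"
    and d_mult: "d (x * y) = d x * y + x * d y"
begin

lemma d_diff: "d (x - y) = d x - d y"
  using d_add[of "x - y" y] by simp

lemma doubleD: "a + a = 0 \<Longrightarrow> a = (0::'a)"
  using two_torsion_free unfolding two_torsion_free_def by blast

lemma commuting_of_double_commutator:
  assumes dc: "\<And>x. x \<in> U \<Longrightarrow> commutator (commutator (d x) x) x = 0"
    and x: "x \<in> U"
  shows "commutator (d x) x = 0"
proof -
  define a where "a = d x"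
  define f where "f = commutator a x"
  have fx: "commutator f x = 0" using dc[OF x] unfolding f_def a_def .
  note mem = add_mem diff_mem mult_mem x
  let ?T = "\<lambda>y. commutator (commutator a y + commutator (d y) x) x + commutator f y"
  have T: "?T y = 0" if y: "y \<in> U" for y
  proof (rule doubleD)
    let ?P = "\<lambda>x. commutator (commutator (d x) x) x"
    \<comment> \<open>The terms odd in \<open>y\<close> survive doubled: the linear part
      \<open>?T y\<close> and the cubic part \<open>?P y\<close>.\<close>
    have "?T y + ?T y = ?P (x + y) - ?P (x - y) - ?P y - ?P y"
      unfolding f_def a_def commutator_def d_add d_diff by (simp add: algebra_simps)
    then show "?T y + ?T y = 0" by (simp add: dc mem y)
  qed
  let ?G = "\<lambda>y. commutator y x * f + commutator y x * f + commutator y x * f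
      + commutator (commutator y x) x * a"
  have G: "?G y = 0" if y: "y \<in> U" for y
  proof -
    have "?G y = ?T (y * x) - ?T y * x
        - (y * commutator f x + y * commutator f x + y * commutator f x)"
      unfolding f_def commutator_def d_mult by (simp add: algebra_simps flip: a_def)
    then show ?thesis by (simp add: T fx mem y)
  qed
  let ?F = "\<lambda>y. f * commutator y x + f * commutator y x + f * commutator y x
      + a * commutator (commutator y x) x"
  have F: "?F y = 0" if y: "y \<in> U" for y
  proof -
    have "?F y = ?T (x * y) - x * ?T y
        - (commutator f x * y + commutator f x * y + commutator f x * y)"
      unfolding f_def commutator_def d_mult by (simp add: algebra_simps flip: a_def)
    then show ?thesis by (simp add: T fx mem y)
  qed
  let ?H = "\<lambda>y. f * y * f + f * y * f + f * y * f
      + f * commutator y x * a + f * commutator y x * a"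
  have H: "?H y = 0" if y: "y \<in> U" for y
  proof -
    have "?H y = ?G (a * y) - a * ?G y - commutator f x * y * a"
      unfolding f_def commutator_def by (simp add: algebra_simps)
    then show ?thesis by (simp add: G fx mem y)
  qed
  have fyf: "f * commutator y x * f = 0" if y: "y \<in> U" for y
  proof (rule doubleD)
    have "f * commutator y x * f + f * commutator y x * f = ?H y * x - ?H (y * x)
        - (f * y * commutator f x + f * y * commutator f x + f * y * commutator f x)"
      unfolding f_def commutator_def by (simp add: algebra_simps)
    then show "f * commutator y x * f + f * commutator y x * f = 0"
      by (simp add: H fx mem y)
  qed
  let ?M = "\<lambda>y. f * y * f + f * y * f + f * y * f
      + a * commutator y x * f + a * commutator y x * f"
  have M: "?M y = 0" if y: "y \<in> U" for y
  proof (rule constant_of_commutator_identity)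
    fix z assume z: "z \<in> U"
    \<comment> \<open>The factor \<open>z\<close> keeps \<open>y * (a * z)\<close> in
      \<open>U\<close>. Expanding \<open>?F\<close> there, the second commutator of \<open>z\<close>
      cancels against \<open>a * y * ?F z\<close>; \<open>?K\<close> collects what multiplies the
      first commutator of \<open>z\<close>.\<close>
    let ?K = "f * y * a + f * y * a + f * y * a
      + a * commutator y x * a + a * commutator y x * a - a * y * f"
    have "?K * commutator z x + ?M y * z
        = ?F (y * (a * z)) - ?F y * (a * z) - a * y * ?F z - a * y * commutator f x * z"
      unfolding f_def commutator_def by (simp add: algebra_simps)
    then show "?K * commutator z x + ?M y * z = 0" by (simp add: F fx mem y z)
  qed
  have "f * y * f * z * f = 0" if y: "y \<in> U" and z: "z \<in> U" for y z
  proof (rule doubleD, rule doubleD)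
    \<comment> \<open>By the Leibniz rule \<open>?e\<close> is a sum of three terms:
      \<open>?q\<close> itself, one eliminated by \<open>?H y\<close>, and one eliminated by
      \<open>?M z\<close>.\<close>
    let ?q = "f * y * f * z * f" and ?e = "f * commutator (y * (a * z)) x * f"
    have "?q + ?q + (?q + ?q) = ?H y * z * f + f * y * ?M z - ?e - ?e"
      unfolding f_def commutator_def by (simp add: algebra_simps)
    then show "?q + ?q + (?q + ?q) = 0" by (simp add: H M fyf mem y z)
  qed
  then have "f * y * f = 0" if y: "y \<in> U" for y
    using that by (intro ideal_semiprimeD[of "f * y * f"]) (simp add: mult.assoc mem)
  then have "f = 0" by (rule ideal_semiprimeD)
  then show ?thesis unfolding f_def a_def .
qed

text \<open>The restrictions on \<open>q\<close> and \<open>p\<close> are lifted in turn: equal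
  elements of \<open>U\<close>, two elements of \<open>U\<close>, then \<open>q\<close> arbitrary,
  then \<open>p\<close> arbitrary.\<close>

lemma commutator_annihilates_derivation:
  assumes comm: "\<And>x. x \<in> U \<Longrightarrow> commutator (d x) x = 0"
  shows "commutator r q * s * d p = 0"
proof -
  have lin: "commutator (d x) y + commutator (d y) x = 0" if "x \<in> U" "y \<in> U" for x y
  proof -
    have "commutator (d x) y + commutator (d y) x
        = commutator (d (x + y)) (x + y) - commutator (d x) x - commutator (d y) y"
      unfolding commutator_def d_add by (simp add: algebra_simps)
    then show ?thesis by (simp add: comm that add_mem)
  qed
  have yd: "commutator y x * d x = 0" if x: "x \<in> U" and y: "y \<in> U" for x y
  proof -
    have "commutator y x * d x = (commutator (d x) (y * x) + commutator (d (y * x)) x)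
        - (commutator (d x) y + commutator (d y) x) * x - y * commutator (d x) x - y * commutator (d x) x"
      unfolding commutator_def d_mult by (simp add: algebra_simps)
    then show ?thesis by (simp add: comm lin x y mult_mem)
  qed
  have same: "commutator r x * s * d x = 0" if x: "x \<in> U" for r s x
  proof (rule annihilator_ideal_to_ring)
    fix y assume y: "y \<in> U"
    have "commutator r x * y * d x = commutator (r * y) x * d x - r * (commutator y x * d x)"
      unfolding commutator_def by (simp add: algebra_simps)
    then show "commutator r x * y * d x = 0" by (simp add: yd x y mult_mem)
  qed
  have two: "commutator r x * s * d y = 0" if x: "x \<in> U" and y: "y \<in> U" for r s x y
  proof (rule semiprimeD)
    fix t
    let ?v = "commutator r x * s * d y"
    have "?v = commutator r (x + y) * s * d (x + y) - commutator r x * s * d x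
        - commutator r y * s * d y - commutator r y * s * d x"
      unfolding commutator_def d_add by (simp add: algebra_simps)
    then have v: "?v = - (commutator r y * s * d x)" by (simp add: same x y add_mem)
    have dt: "d y * t * commutator r y = 0"
      by (rule annihilator_swap) (rule same[OF y])
    \<comment> \<open>Rewriting only one factor \<open>?v\<close> by its polarized form brings
      \<open>d y\<close> and \<open>commutator r y\<close> together around \<open>t\<close>.\<close>
    have "?v * t * ?v = - (commutator r x * s * (d y * t * commutator r y) * s * d x)"
      by (subst (2) v) (simp add: mult.assoc)
    then show "?v * t * ?v = 0" by (simp add: dt)
  qed
  have one: "commutator r q * s * d y = 0" if y: "y \<in> U" for r q s y
  proof -
    have "commutator r q * x * (s * d y) = 0" if x: "x \<in> U" for x s
    proof -
      have "commutator r q * x * (s * d y)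
          = commutator r (q * x) * s * d y - q * (commutator r x * s * d y)"
        unfolding commutator_def by (simp add: algebra_simps)
      then show ?thesis by (simp add: two x y mult_mem)
    qed
    then have "commutator r q * t * (s * d y) = 0" for t s
      by (rule annihilator_ideal_to_ring)
    then have "commutator r q * (s * d y) = 0" by (rule annihilator_mult)
    then show ?thesis by (simp add: mult.assoc)
  qed
  show ?thesis
  proof (rule left_annihilatorD)
    fix y assume y: "y \<in> U"
    \<comment> \<open>Since \<open>p * y\<close> lies in \<open>U\<close>, the Leibniz rule reduces
      arbitrary \<open>p\<close> to arguments in \<open>U\<close>.\<close>
    have "commutator r q * s * d p * y
        = commutator r q * s * d (p * y) - commutator r q * (s * p) * d y"
      unfolding d_mult by (simp add: algebra_simps)
    then show "commutator r q * s * d p * y = 0" by (simp add: one y mult_mem)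
  qed
qed

lemma commuting_imp_central:
  assumes comm: "\<And>x. x \<in> U \<Longrightarrow> commutator (d x) x = 0"
  shows "d p \<in> ring_center" and "d p * r \<in> ring_center"
proof -
  note ann = commutator_annihilates_derivation[OF comm]
  have central: "commutator (d p) q = 0" for q
  proof (rule semiprimeD)
    fix s
    let ?v = "commutator (d p) q"
    \<comment> \<open>Only the right factor is expanded; the left one stays a commutator, so
      \<open>ann\<close> kills both terms.\<close>
    have "?v * s * ?v = ?v * s * d p * q - ?v * (s * q) * d p"
      by (subst (2) commutator_def) (simp add: algebra_simps)
    then show "?v * s * ?v = 0" by (simp add: ann)
  qed
  then show center: "d p \<in> ring_center" by (simp add: ring_center_def commutator_def)
  have "d p * commutator r q = 0" for q
    by (rule annihilator_mult, rule annihilator_swap, rule ann)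
  moreover have "d p * r * q - q * (d p * r) = d p * commutator r q + commutator (d p) q * r" for q
    unfolding commutator_def by (simp add: algebra_simps)
  ultimately show "d p * r \<in> ring_center" using central by (simp add: ring_center_def)
qed

end

section \<open>Ideals inside the center and transport along the automorphism\<close>

lemma two_sided_ideal_absorbing_center:
  "two_sided_ideal {z::'a::ring. z \<in> ring_center \<and> (\<forall>r. z * r \<in> ring_center)}"
proof -
  have "r * z \<in> ring_center" "r * (z * q) \<in> ring_center"
    if "z \<in> ring_center" "\<forall>r. z * r \<in> ring_center" for z r q :: 'a
  proof -
    have "r * z = z * r" using that(1) by (simp add: ring_center_def)
    then show "r * z \<in> ring_center" "r * (z * q) \<in> ring_center"
      using that(2) by (metis mult.assoc)+
  qed
  moreover have "z + w \<in> ring_center" "- z \<in> ring_center"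
    if "z \<in> ring_center" "w \<in> ring_center" for z w :: 'a
    using that by (auto simp: ring_center_def distrib_left distrib_right)
  moreover have "0 \<in> (ring_center :: 'a set)" by (simp add: ring_center_def)
  ultimately show ?thesis
    unfolding two_sided_ideal_def additive_subgroup_def
    by (auto simp: distrib_right mult.assoc)
qed

text \<open>Minimality of the hull is applied to the largest ideal contained in the center, so the
  elements of the generated ideal need no explicit description.\<close>

lemma ideal_generated_by_subset_center:
  assumes "\<And>z. z \<in> S \<Longrightarrow> z \<in> ring_center" "\<And>z r. z \<in> S \<Longrightarrow> z * r \<in> ring_center"
  shows "ideal_generated_by S \<subseteq> (ring_center :: 'a::ring set)"
proof -
  have "ideal_generated_by S \<subseteq> {z. z \<in> ring_center \<and> (\<forall>r. z * r \<in> ring_center)}"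
    unfolding ideal_generated_by_def
    by (rule hull_minimal) (use assms two_sided_ideal_absorbing_center in auto)
  then show ?thesis by blast
qed

lemma ring_automorphism_center:
  assumes "ring_automorphism \<alpha>" and "z \<in> ring_center"
  shows "\<alpha> z \<in> ring_center"
proof -
  have "\<alpha> z * x = x * \<alpha> z" for x
  proof -
    obtain y where x: "x = \<alpha> y"
      using assms(1) unfolding ring_automorphism_def by (metis bij_pointE)
    have "\<alpha> (z * y) = \<alpha> (y * z)"
      using assms(2) unfolding ring_center_def by (blast intro: arg_cong)
    then show ?thesis
      using assms(1) unfolding ring_automorphism_def x by simp
  qed
  then show ?thesis by (simp add: ring_center_def)
qed

theorem theorem3p6:
  fixes U :: "'a::ring set" and \<alpha> D :: "'a \<Rightarrow> 'a"
  assumes "two_torsion_free TYPE('a)"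
    and "semiprime_ring TYPE('a)"
    and "left_ideal U"
    and "U \<noteq> {0}"
    and "right_annihilator U = {0}"
    and "ring_automorphism \<alpha>"
    and "twisted_derivation \<alpha> D"
    and "\<And>x. x \<in> U \<Longrightarrow> commutator (commutator (D x) (\<alpha> x)) (\<alpha> x) = 0"
  shows "range D \<subseteq> ring_center \<and> ideal_generated_by (range D) \<subseteq> ring_center"
proof -
  define d where "d x = inv \<alpha> (D x)" for x
  have bij: "bij \<alpha>" and additive: "additive \<alpha>" and mult: "\<And>x y. \<alpha> (x * y) = \<alpha> x * \<alpha> y"
    using assms(6) unfolding ring_automorphism_def by auto
  note add = additive.add[OF additive] and diff = additive.diff[OF additive]
  have eqD: "x = y" if "\<alpha> x = \<alpha> y" for x y
    using bij that by (meson bij_is_inj injD)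
  have D: "D x = \<alpha> (d x)" for x
    unfolding d_def using bij by (simp add: bij_is_surj surj_f_inv_f)
  have D_add: "D (x + y) = D x + D y" and D_mult: "D (x * y) = D x * \<alpha> y + \<alpha> x * D y" for x y
    using assms(7) unfolding twisted_derivation_def by (auto simp: additive.add)
  interpret faithful_left_ideal_derivation U d
  proof
    fix x y
    show "d (x + y) = d x + d y"
      by (rule eqD) (simp add: add D_add flip: D)
    show "d (x * y) = d x * y + x * d y"
      by (rule eqD) (simp add: add mult D_mult flip: D)
  qed (use assms in auto)
  have "commutator (commutator (d x) x) x = 0" if "x \<in> U" for x
  proof (rule eqD)
    show "\<alpha> (commutator (commutator (d x) x) x) = \<alpha> 0"
      using assms(8)[OF that] by (simp add: commutator_def diff mult D additive.zero[OF additive])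
  qed
  then have "commutator (d x) x = 0" if "x \<in> U" for x
    using commuting_of_double_commutator that by blast
  note central = commuting_imp_central[OF this]
  have 1: "D p \<in> ring_center" for p
    unfolding D by (rule ring_automorphism_center[OF assms(6) central(1)])
  have 2: "D p * r \<in> ring_center" for p r
  proof -
    have "D p * r = \<alpha> (d p * inv \<alpha> r)"
      using bij by (simp add: mult D bij_is_surj surj_f_inv_f)
    then show ?thesis
      using ring_automorphism_center[OF assms(6) central(2)] by simp
  qed
  have "ideal_generated_by (range D) \<subseteq> ring_center"
    by (rule ideal_generated_by_subset_center) (use 1 2 in blast)+
  then show ?thesis using 1 by blast
qed

end
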